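(* Let $\mathcal{X}$ be a finite alphabet and $\mathcal{Y}$ a countable alphabet. Let $\mathbb{X}=(X_1,X_2,\dots)$ and $\mathbb{Y}=(Y_1,Y_2,\dots)$ be a pair of random sequences with $X_i\in\mathcal{X}$ and $Y_i\in\mathcal{Y}$, and for each $n$ let $G(X_{1,n}|Y_{1,n})$ be an optimal guessing function of $X_{1,n}=(X_1,\dots,X_n)$ given $Y_{1,n}=(Y_1,\dots,Y_n)$. Let $$\Lambda(\alpha)=\lim_{n\to\infty}\frac1n\log\mathbb{E}\,G(X_{1,n}|Y_{1,n})^\alpha .$$ Suppose that $\Lambda(\alpha)$ exists for all $\alpha>-1$, that $\Lambda$ has a continuous derivative on $(-1,\infty)$, and that $\Lambda(\alpha)=\alpha H_{1/(1+\alpha)}(\mathbb{X}|\mathbb{Y})$ for all $\alpha>-1$. Let $$\Lambda^*(x)=\sup_{\alpha\in\mathbb{R}}\big(x\alpha-\Lambda(\alpha)\big),\qquad x\in\mathbb{R}.$$ Then the sequence $\{n^{-1}\log G(X_{1,n}|Y_{1,n})\}_{n\in\mathbb{N}}$ satisfies the large deviation principle with the rate function $\Lambda^*$, i.e., for any closed set $F\subset\mathbb{R}$, $$ \limsup_{n\to\infty}\frac{1}{n}\log\mathbb{P}\big(n^{-1}\log G(X_{1, n}|Y_{1, n})\in F\big)\leq-\inf_{x\in F}\Lambda^*(x), $$ and for any open set $J\subset\mathbb{R}$, $$ \liminf_{n\to\infty}\frac{1}{n}\log\mathbb{P}\big(n^{-1}\log G(X_{1, n}|Y_{1, n})\in J\big)\geq-\inf_{x\in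 J}\Lambda^*(x). $$
   Context: A guessing function of $X_{1,n}$ given $Y_{1,n}$ is a function $(x,y)\mapsto G(x|y)$ on $\mathcal{X}^n\times\mathcal{Y}^n$ such that for every $y$ the map $x\mapsto G(x|y)$ is a one-to-one function $\mathcal{X}^n\to\{1,\dots,|\mathcal{X}|^n\}$; $G(X_{1,n}|Y_{1,n})$ is its value at $(X_{1,n},Y_{1,n})$. It is optimal if, for each $y$ with $\mathbb{P}(Y_{1,n}=y)>0$, guesses are made from the most likely to the least likely value, i.e. $G(x'|y)\le G(x|y)$ implies $p_{X_{1,n}|Y_{1,n}}(x'|y)\ge p_{X_{1,n}|Y_{1,n}}(x|y)$. For $\beta>0$, $\beta\neq1$, the conditional Rényi entropy of order $\beta$ of a discrete $X$ given a discrete $Y$ is $$H_\beta(X|Y)=\frac{\beta}{1-\beta}\log\sum_{y}\Big(\sum_{x}p_{X,Y}(x,y)^\beta\Big)^{1/\beta},$$ and $H_1(X|Y)$ is the conditional Shannon entropy (the limit as $\beta\to1$). For sequences, $H_\beta(\mathbb{X}|\mathbb{Y})=\lim_{n\to\infty}\frac1n H_\beta(X_{1,n}|Y_{1,n})$, provided the limit exists. In the definition of $\Lambda^*$, $\Lambda(\alpha)$ for $\alpha\le-1$ is given by the same limit; under the stated hypotheses this limit exists for all $\alpha\le-1$ and equals $-H_\infty(\mathbb{X}|\mathbb{Y})$, where $H_\infty(\mathbb{X}|\mathbb{Y})=-\lim_{n\to\infty}\frac1n\log\mathbb{P}(G(X_{1,n}|Y_{1,n})=1)$. Conventions: $\log$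 is the natural logarithm, $\log 0=-\infty$, $\inf\emptyset=+\infty$, and $\Lambda^*$ may take the value $+\infty$. *)

theory Defs
  imports "HOL-Probability.Probability"
begin

text \<open>Sequences are indexed from 1. The values \<open>X\<^sub>1, \<dots>, X\<^sub>n\<close> form a word, and the \<open>n\<close>-fold
  product of an alphabet is the set of its words of length \<open>n\<close>.\<close>

definition initial_word :: "(nat \<Rightarrow> 'a \<Rightarrow> 'b) \<Rightarrow> nat \<Rightarrow> 'a \<Rightarrow> 'b list" where
  "initial_word X n \<omega> = map (\<lambda>i. X i \<omega>) [1..<n + 1]"

definition words :: "nat \<Rightarrow> 'b list set" where
  "words n = {w. length w = n}"

text \<open>\<open>g x y\<close> stands for \<open>G(x|y)\<close>.\<close>

definition guessing_function :: "nat \<Rightarrow> ('x::finite list \<Rightarrow> 'y list \<Rightarrow> nat) \<Rightarrow> bool" where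
  "guessing_function n g \<longleftrightarrow>
     (\<forall>y\<in>words n. inj_on (\<lambda>x. g x y) (words n) \<and>
        (\<forall>x\<in>words n. g x y \<in> {1..CARD('x) ^ n}))"

definition optimal_guessing_function ::
  "'a measure \<Rightarrow> (nat \<Rightarrow> 'a \<Rightarrow> 'x::finite) \<Rightarrow> (nat \<Rightarrow> 'a \<Rightarrow> 'y) \<Rightarrow> nat
     \<Rightarrow> ('x list \<Rightarrow> 'y list \<Rightarrow> nat) \<Rightarrow> bool" where
  "optimal_guessing_function M X Y n g \<longleftrightarrow>
     guessing_function n g \<and>
     (\<forall>y\<in>words n. \<P>(\<omega> in M. initial_word Y n \<omega> = y) > 0 \<longrightarrow>
        (\<forall>x\<in>words n. \<forall>x'\<in>words n. g x' y \<le> g x y \<longrightarrow>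
           \<P>(\<omega> in M. initial_word X n \<omega> = x' \<bar> initial_word Y n \<omega> = y)
             \<ge> \<P>(\<omega> in M. initial_word X n \<omega> = x \<bar> initial_word Y n \<omega> = y)))"

text \<open>Conditional Renyi entropy (Arimoto's form), in nats. If \<open>U\<close> takes finitely many values, as
  the words over a finite alphabet do, then all sums converge: the inner one has finitely many
  nonzero terms, and for \<open>k\<close> values it is at most \<open>max 1 (k powr (1 - \<beta>)) * P(V = v) powr \<beta>\<close>.\<close>

definition cond_renyi_entropy ::
  "'a measure \<Rightarrow> real \<Rightarrow> ('a \<Rightarrow> 'u::countable) \<Rightarrow> ('a \<Rightarrow> 'v::countable) \<Rightarrow> real" where
  "cond_renyi_entropy M \<beta> U V =
     (if \<beta> = 1
      then prob_space.conditional_entropy M (exp 1) (count_space UNIV) (count_space UNIV) U V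
      else \<beta> / (1 - \<beta>) *
        ln (\<Sum>\<^sub>\<infinity>v. (\<Sum>\<^sub>\<infinity>u. \<P>(\<omega> in M. U \<omega> = u \<and> V \<omega> = v) powr \<beta>) powr (1 / \<beta>)))"

definition renyi_per_symbol ::
  "'a measure \<Rightarrow> (nat \<Rightarrow> 'a \<Rightarrow> 'x::countable) \<Rightarrow> (nat \<Rightarrow> 'a \<Rightarrow> 'y::countable)
     \<Rightarrow> real \<Rightarrow> nat \<Rightarrow> real" where
  "renyi_per_symbol M X Y \<beta> n =
     cond_renyi_entropy M \<beta> (initial_word X n) (initial_word Y n) / real n"

definition renyi_rate ::
  "'a measure \<Rightarrow> (nat \<Rightarrow> 'a \<Rightarrow> 'x::countable) \<Rightarrow> (nat \<Rightarrow> 'a \<Rightarrow> 'y::countable) \<Rightarrow> real \<Rightarrow> real" where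
  "renyi_rate M X Y \<beta> = lim (renyi_per_symbol M X Y \<beta>)"

definition guesswork ::
  "(nat \<Rightarrow> 'a \<Rightarrow> 'x) \<Rightarrow> (nat \<Rightarrow> 'a \<Rightarrow> 'y) \<Rightarrow> (nat \<Rightarrow> 'x list \<Rightarrow> 'y list \<Rightarrow> nat)
     \<Rightarrow> nat \<Rightarrow> 'a \<Rightarrow> real" where
  "guesswork X Y G n \<omega> = real (G n (initial_word X n \<omega>) (initial_word Y n \<omega>))"

text \<open>For a guessing function \<open>1 \<le> guesswork X Y G n \<omega> \<le> CARD('x) ^ n\<close>, so the expectation below is
  positive and \<open>scaled_cgf\<close> is bounded in \<open>n\<close>; a limit is therefore a real number.\<close>

definition scaled_cgf ::
  "'a measure \<Rightarrow> (nat \<Rightarrow> 'a \<Rightarrow> 'x) \<Rightarrow> (nat \<Rightarrow> 'a \<Rightarrow> 'y) \<Rightarrow> (nat \<Rightarrow> 'x list \<Rightarrow> 'y list \<Rightarrow> nat)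
     \<Rightarrow> real \<Rightarrow> nat \<Rightarrow> real" where
  "scaled_cgf M X Y G \<alpha> n =
     ln (prob_space.expectation M (\<lambda>\<omega>. guesswork X Y G n \<omega> powr \<alpha>)) / real n"

definition limit_cgf ::
  "'a measure \<Rightarrow> (nat \<Rightarrow> 'a \<Rightarrow> 'x) \<Rightarrow> (nat \<Rightarrow> 'a \<Rightarrow> 'y) \<Rightarrow> (nat \<Rightarrow> 'x list \<Rightarrow> 'y list \<Rightarrow> nat)
     \<Rightarrow> real \<Rightarrow> real" where
  "limit_cgf M X Y G \<alpha> = lim (scaled_cgf M X Y G \<alpha>)"

definition legendre_transform :: "(real \<Rightarrow> real) \<Rightarrow> real \<Rightarrow> ereal" where
  "legendre_transform L x = (SUP \<alpha>. ereal (x * \<alpha> - L \<alpha>))"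

text \<open>The logarithm of a probability, with \<open>log 0 = -\<infinity>\<close> (\<open>ln 0\<close> is \<open>0\<close> on the reals).\<close>

definition log_prob :: "real \<Rightarrow> ereal" where
  "log_prob p = (if p = 0 then -\<infinity> else ereal (ln p))"

end

theory Submission
  imports Defs
begin

text \<open>Optimality makes \<open>p\<^sub>k = P(G = k)\<close> decreasing in \<open>k\<close>. Hence \<open>E G powr \<alpha>\<close> lies between \<open>p\<^sub>1\<close> and
  \<open>p\<^sub>1 \<Sum>\<^sub>k k powr \<alpha>\<close>, so that \<open>n\<^sup>-\<^sup>1 log p\<^sub>1\<close> converges to the limit \<open>h\<close> of \<open>\<Lambda>\<close> at \<open>-1\<close>, and \<open>\<Lambda> = h\<close> on
  \<open>(-\<infinity>, -1]\<close>. The upper bound is Chernoff's inequality with a compactness argument. The lower bound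
  at the values of \<open>\<Lambda>'\<close> on \<open>(-1, \<infinity>)\<close> is the tilting argument of Gaertner and Ellis. It does not reach
  the points below these values, where \<open>\<Lambda>\<^sup>*\<close> is affine because \<open>\<Lambda>\<close> may have a kink at \<open>-1\<close>; there,
  monotonicity of \<open>p\<^sub>k\<close> transports the bound from \<open>\<Lambda>' (\<alpha>)\<close>, \<open>\<alpha> \<rightarrow> -1+\<close>, to all smaller points.\<close>

section \<open>Large deviations of bounded random variables\<close>

text \<open>The limit \<open>L a\<close> is supposed at every real order. Differentiability is left
  to the single lemmas, since for guesswork it is given only above -1.\<close>

locale bounded_cgf = prob_space +
  fixes W :: "nat \<Rightarrow> 'a \<Rightarrow> real" and A :: real and L :: "real \<Rightarrow> real"
  assumes W_measurable: "\<And>n. n \<ge> 1 \<Longrightarrow> W n \<in> borel_measurable M"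
    and W_bounded: "\<And>n \<omega>. n \<ge> 1 \<Longrightarrow> \<omega> \<in> space M \<Longrightarrow> \<bar>W n \<omega>\<bar> \<le> A"
    and cgf_tendsto:
      "\<And>a. (\<lambda>n. ln (expectation (\<lambda>\<omega>. exp (real n * a * W n \<omega>))) / real n) \<longlonglongrightarrow> L a"
begin

definition mgf :: "real \<Rightarrow> nat \<Rightarrow> real" where
  "mgf a n = expectation (\<lambda>\<omega>. exp (real n * a * W n \<omega>))"

lemma exp_W_integrable:
  assumes "n \<ge> 1"
  shows "integrable M (\<lambda>\<omega>. exp (real n * a * W n \<omega>))"
proof (rule integrable_const_bound[where B = "exp (real n * \<bar>a\<bar> * A)"])
  have "real n * a * W n \<omega> \<le> real n * \<bar>a\<bar> * A" if "\<omega> \<in> space M" for \<omega>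
  proof -
    have "a * W n \<omega> \<le> \<bar>a\<bar> * \<bar>W n \<omega>\<bar>" by (metis abs_ge_self abs_mult)
    also have "\<dots> \<le> \<bar>a\<bar> * A" using W_bounded[OF assms that] by (intro mult_left_mono) auto
    finally show ?thesis by (simp add: mult.assoc mult_left_mono)
  qed
  then show "AE \<omega> in M. norm (exp (real n * a * W n \<omega>)) \<le> exp (real n * \<bar>a\<bar> * A)"
    by (intro AE_I2) simp
  show "(\<lambda>\<omega>. exp (real n * a * W n \<omega>)) \<in> borel_measurable M"
    using W_measurable[OF assms] by measurable
qed

text \<open>Strict positivity makes \<open>ln (mgf a n)\<close> meaningful, so that its limit turns
  back into exponential bounds on \<open>mgf a n\<close>.\<close>

lemma mgf_pos:
  assumes "n \<ge> 1"
  shows "mgf a n > 0"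
proof -
  have "mgf a n \<noteq> 0"
    unfolding mgf_def using integral_nonneg_eq_0_iff_AE[OF exp_W_integrable[OF assms, of a]]
    by (simp add: AE_False)
  moreover have "mgf a n \<ge> 0" by (simp add: mgf_def)
  ultimately show ?thesis by simp
qed

lemma eventually_mgf_le:
  assumes "c > L a"
  shows "\<forall>\<^sub>F n in sequentially. mgf a n \<le> exp (real n * c)"
  using order_tendstoD(2)[OF cgf_tendsto assms] eventually_ge_at_top[of 1]
proof eventually_elim
  case (elim n)
  then have "ln (mgf a n) < real n * c"
    by (simp add: mgf_def field_simps)
  with mgf_pos[OF elim(2), of a] show ?case
    by (metis exp_ln exp_less_cancel_iff less_imp_le)
qed

lemma eventually_mgf_ge:
  assumes "c < L a"
  shows "\<forall>\<^sub>F n in sequentially. mgf a n \<ge> exp (real n * c)"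
  using order_tendstoD(1)[OF cgf_tendsto assms] eventually_ge_at_top[of 1]
proof eventually_elim
  case (elim n)
  then have "ln (mgf a n) > real n * c"
    by (simp add: mgf_def field_simps)
  with mgf_pos[OF elim(2), of a] show ?case
    by (metis exp_ln exp_less_cancel_iff less_imp_le)
qed

text \<open>Chernoff's inequality for either sign of \<open>a\<close>. With \<open>b = L a\<close>
  the event says that the affine function of order \<open>a\<close> in the Legendre transform
  exceeds \<open>c\<close> at \<open>W n\<close>.\<close>

lemma prob_le_mgf:
  assumes "n \<ge> 1"
  shows "\<P>(\<omega> in M. W n \<omega> * a - b > c) \<le> exp (- real n * (b + c)) * mgf a n"
proof -
  have [measurable]: "W n \<in> borel_measurable M" by (rule W_measurable[OF assms])
  let ?E = "{\<omega> \<in> space M. W n \<omega> * a - b > c}"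
  have "prob ?E = (\<integral>\<omega>. indicator ?E \<omega> \<partial>M)" by simp
  also have "\<dots> \<le> (\<integral>\<omega>. exp (- real n * (b + c)) * exp (real n * a * W n \<omega>) \<partial>M)"
  proof (rule integral_mono)
    show "integrable M (indicator ?E :: 'a \<Rightarrow> real)"
      by (rule integrable_real_indicator) (simp_all add: emeasure_eq_measure)
    show "integrable M (\<lambda>\<omega>. exp (- real n * (b + c)) * exp (real n * a * W n \<omega>))"
      using exp_W_integrable[OF assms] by (rule integrable_mult_right)
    show "indicator ?E \<omega> \<le> exp (- real n * (b + c)) * exp (real n * a * W n \<omega>)"
      if "\<omega> \<in> space M" for \<omega>
    proof (cases "\<omega> \<in> ?E")
      case True
      then have "0 \<le> real n * (W n \<omega> * a - b - c)" by simp
      then have "0 \<le> - real n * (b + c) + real n * a * W n \<omega>" by (simp add: algebra_simps)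
      with True show ?thesis by (simp add: exp_add[symmetric] del: mult_minus_left)
    qed simp
  qed
  also have "\<dots> = exp (- real n * (b + c)) * mgf a n" by (simp add: mgf_def)
  finally show ?thesis .
qed

text \<open>Every point of \<open>F\<close> has an order \<open>a\<close> whose affine function
  exceeds \<open>c\<close> there. By compactness finitely many orders suffice, and their Chernoff
  bounds add up.\<close>

lemma eventually_prob_closed_le:
  assumes "closed F" "ereal c < (INF x\<in>F. legendre_transform L x)" "r > - c"
  shows "\<forall>\<^sub>F n in sequentially. \<P>(\<omega> in M. W n \<omega> \<in> F) \<le> exp (real n * r)"
proof -
  define U where "U a = {z::real. z * a - L a > c}" for a
  have "\<exists>a. x \<in> U a" if "x \<in> F" for x
  proof -
    have "ereal c < legendre_transform L x" using assms(2) that by (meson INF_lower less_le_trans)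
    then show ?thesis by (auto simp: legendre_transform_def less_SUP_iff U_def)
  qed
  moreover have "open (U a)" for a
    unfolding U_def by (intro open_Collect_less continuous_intros)
  \<comment> \<open>\<open>W n\<close> never leaves \<open>{- A..A}\<close>, so cutting
    \<open>F\<close> down to a compact set loses no probability.\<close>
  moreover have "compact (F \<inter> {- A..A})"
    using assms(1) by (simp add: closed_Int_compact)
  ultimately obtain T where T: "finite T" "F \<inter> {- A..A} \<subseteq> (\<Union>a\<in>T. U a)"
    by (elim compactE_image[where C = UNIV and f = U]) auto
  \<comment> \<open>One \<open>d\<close> pays for replacing \<open>mgf a n\<close> by its limit
    rate, a second for the number of orders in \<open>T\<close>; the total \<open>2 * d - c\<close>
    stays below \<open>r = 3 * d - c\<close>.\<close>
  define d where "d = (r + c) / 3"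
  have d: "d > 0" using assms(3) by (simp add: d_def)
  have "\<forall>\<^sub>F n in sequentially. \<forall>a\<in>T. mgf a n \<le> exp (real n * (L a + d))"
    using T(1) d by (intro eventually_ball_finite ballI eventually_mgf_le) auto
  moreover have "\<forall>\<^sub>F n in sequentially. real (card T) \<le> exp (real n * d)"
    using d by real_asymp
  ultimately show ?thesis using eventually_ge_at_top[of 1]
  proof eventually_elim
    case (elim n)
    have [measurable]: "W n \<in> borel_measurable M" by (rule W_measurable[OF elim(3)])
    have [measurable]: "F \<in> sets borel" using assms(1) by auto
    have "\<P>(\<omega> in M. W n \<omega> \<in> F) \<le> prob (\<Union>a\<in>T. {\<omega> \<in> space M. W n \<omega> * a - L a > c})"
    proof (intro finite_measure_mono)
      show "{\<omega> \<in> space M. W n \<omega> \<in> F} \<subseteq> (\<Union>a\<in>T. {\<omega> \<in> space M. W n \<omega> * a - L a > c})"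
        using T(2) W_bounded[OF elim(3)] by (fastforce simp: U_def abs_le_iff)
    qed (use T(1) in \<open>auto intro!: sets.finite_UN\<close>)
    also have "\<dots> \<le> (\<Sum>a\<in>T. \<P>(\<omega> in M. W n \<omega> * a - L a > c))"
      using T(1) by (intro finite_measure_subadditive_finite) auto
    also have "\<dots> \<le> (\<Sum>a\<in>T. exp (real n * (d - c)))"
    proof (rule sum_mono)
      fix a assume a: "a \<in> T"
      have "\<P>(\<omega> in M. W n \<omega> * a - L a > c) \<le> exp (- real n * (L a + c)) * mgf a n"
        by (rule prob_le_mgf[OF elim(3)])
      also have "\<dots> \<le> exp (- real n * (L a + c)) * exp (real n * (L a + d))"
        using elim(1) a by (intro mult_left_mono) auto
      also have "\<dots> = exp (real n * (d - c))" by (simp add: exp_add[symmetric] algebra_simps)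
      finally show "\<P>(\<omega> in M. W n \<omega> * a - L a > c) \<le> exp (real n * (d - c))" .
    qed
    also have "\<dots> = real (card T) * exp (real n * (d - c))" by simp
    also have "\<dots> \<le> exp (real n * d) * exp (real n * (d - c))"
      using elim(2) by (intro mult_right_mono) auto
    also have "\<dots> = exp (real n * (2 * d - c))" by (simp add: exp_add[symmetric] algebra_simps)
    also have "\<dots> \<le> exp (real n * r)"
    proof -
      have "2 * d - c \<le> r" using d unfolding d_def by argo
      then show ?thesis by (simp add: mult_left_mono)
    qed
    finally show ?case .
  qed
qed

text \<open>Under the law tilted by \<open>exp (n a W)\<close>, the tails of \<open>W n\<close> away from \<open>L' a\<close> are exponentially
  small, because \<open>L (a + t) - L a - t (L' a + e) < 0\<close> for small \<open>t > 0\<close>, and likewise on the other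
  side.\<close>

lemma eventually_prob_ball_ge:
  assumes "(L has_real_derivative y) (at a)" "e > 0" "\<delta> > 0"
  shows "\<forall>\<^sub>F n in sequentially. \<P>(\<omega> in M. \<bar>W n \<omega> - y\<bar> < e) \<ge> exp (real n * (L a - a * y - \<delta>))"
proof -
  \<comment> \<open>The second bound makes \<open>exp (n a W)\<close> vary by a factor of at most
    \<open>exp (n \<delta> / 2)\<close> above its value at \<open>y\<close> on the ball.\<close>
  define \<epsilon> where "\<epsilon> = min e (\<delta> / (2 * (\<bar>a\<bar> + 1)))"
  have \<epsilon>: "\<epsilon> > 0" "\<epsilon> \<le> e" using assms by (auto simp: \<epsilon>_def)
  have "\<bar>a\<bar> * \<epsilon> \<le> (\<bar>a\<bar> + 1) * (\<delta> / (2 * (\<bar>a\<bar> + 1)))"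
    using \<epsilon> assms by (intro mult_mono) (auto simp: \<epsilon>_def)
  also have "\<dots> = \<delta> / 2" by (simp add: field_simps)
  finally have a\<epsilon>: "\<bar>a\<bar> * \<epsilon> \<le> \<delta> / 2" .
  have "((\<lambda>h. (L (a + h) - L a) / h) \<longlongrightarrow> y) (at 0)"
    using assms(1) by (simp add: DERIV_def)
  then obtain s where s: "s > 0" "\<And>h. h \<noteq> 0 \<Longrightarrow> \<bar>h\<bar> < s \<Longrightarrow> \<bar>(L (a + h) - L a) / h - y\<bar> < \<epsilon> / 2"
    using \<epsilon>(1) unfolding tendsto_iff eventually_at dist_real_def
    by (metis UNIV_I diff_zero half_gt_zero)
  define t where "t = s / 2"
  have t: "t > 0" "t < s" using s(1) by (auto simp: t_def)
  have up: "L (a + t) < L a + t * y + t * \<epsilon> / 2"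
  proof -
    have "\<bar>(L (a + t) - L a) / t - y\<bar> < \<epsilon> / 2" using s(2)[of t] t by simp
    then have "(L (a + t) - L a) / t < y + \<epsilon> / 2" by linarith
    then show ?thesis using t by (simp add: pos_divide_less_eq algebra_simps)
  qed
  have lo: "L (a - t) < L a - t * y + t * \<epsilon> / 2"
  proof -
    have "\<bar>(L a - L (a - t)) / t - y\<bar> < \<epsilon> / 2"
      using s(2)[of "- t"] t by (simp add: diff_divide_distrib)
    then have "(L a - L (a - t)) / t > y - \<epsilon> / 2" by linarith
    then show ?thesis using t by (simp add: field_simps)
  qed
  \<comment> \<open>The main term is at least \<open>exp (n (L a - \<eta>))\<close> and each tail at
    most \<open>exp (n (L a - 4 \<eta>))\<close>, which leaves an exponential gap
    \<open>3 \<eta>\<close>.\<close>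
  define \<eta> where "\<eta> = min (t * \<epsilon> / 8) (\<delta> / 4)"
  have \<eta>: "\<eta> > 0" "4 * \<eta> \<le> t * \<epsilon> / 2" "\<eta> \<le> \<delta> / 4" using t \<epsilon> assms by (auto simp: \<eta>_def)
  have "\<forall>\<^sub>F n in sequentially. mgf a n \<ge> exp (real n * (L a - \<eta>))"
    using \<eta> by (intro eventually_mgf_ge) simp
  moreover have "\<forall>\<^sub>F n in sequentially. mgf (a + t) n \<le> exp (real n * (L a + t * y + t * \<epsilon> / 2))"
    using up by (rule eventually_mgf_le)
  moreover have "\<forall>\<^sub>F n in sequentially. mgf (a - t) n \<le> exp (real n * (L a - t * y + t * \<epsilon> / 2))"
    using lo by (rule eventually_mgf_le)
  moreover have "\<forall>\<^sub>F n in sequentially. 4 * exp (real n * (-3 * \<eta>)) \<le> 1"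
    using \<eta>(1) by real_asymp
  moreover have "\<forall>\<^sub>F n in sequentially. 2 * exp (real n * (- \<delta> / 4)) \<le> 1"
    using assms(3) by real_asymp
  ultimately show ?thesis using eventually_ge_at_top[of 1]
  proof eventually_elim
    case (elim n)
    have [measurable]: "W n \<in> borel_measurable M" by (rule W_measurable[OF elim(6)])
    let ?B = "{\<omega> \<in> space M. \<bar>W n \<omega> - y\<bar> < \<epsilon>}"
    let ?c1 = "exp (real n * (a * y + \<delta> / 2))"
    let ?c2 = "exp (- real n * t * (y + \<epsilon>))"
    let ?c3 = "exp (real n * t * (y - \<epsilon>))"
    let ?E = "\<lambda>b \<omega>. exp (real n * b * W n \<omega>)"
    have int: "integrable M (\<lambda>\<omega>. indicator ?B \<omega> * ?c1)"
      by (intro integrable_mult_left integrable_real_indicator) (simp_all add: emeasure_eq_measure)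
    \<comment> \<open>On the ball the integrand is at most \<open>?c1\<close>. Above it the factor
      \<open>exp (n t (W - y - \<epsilon>))\<close> is at least 1 and raises the order to
      \<open>a + t\<close>; below it the mirrored factor lowers the order to
      \<open>a - t\<close>.\<close>
    have "mgf a n \<le> (\<integral>\<omega>. indicator ?B \<omega> * ?c1 + ?c2 * ?E (a + t) \<omega> + ?c3 * ?E (a - t) \<omega> \<partial>M)"
      unfolding mgf_def
    proof (rule integral_mono)
      show "integrable M (?E a)" by (rule exp_W_integrable[OF elim(6)])
      show "integrable M (\<lambda>\<omega>. indicator ?B \<omega> * ?c1 + ?c2 * ?E (a + t) \<omega> + ?c3 * ?E (a - t) \<omega>)"
        by (intro Bochner_Integration.integrable_add int integrable_mult_right exp_W_integrable[OF elim(6)])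
      fix \<omega> assume \<omega>: "\<omega> \<in> space M"
      have nonneg: "indicator ?B \<omega> * ?c1 \<ge> 0" "?c2 * ?E (a + t) \<omega> \<ge> 0" "?c3 * ?E (a - t) \<omega> \<ge> 0"
        by simp_all
      consider "\<bar>W n \<omega> - y\<bar> < \<epsilon>" | "W n \<omega> \<ge> y + \<epsilon>" | "W n \<omega> \<le> y - \<epsilon>" by linarith
      then have "?E a \<omega> \<le> indicator ?B \<omega> * ?c1 \<or> ?E a \<omega> \<le> ?c2 * ?E (a + t) \<omega> \<or> ?E a \<omega> \<le> ?c3 * ?E (a - t) \<omega>"
      proof cases
        case 1
        have "a * (W n \<omega> - y) \<le> \<bar>a\<bar> * \<epsilon>"
          using 1 by (metis abs_ge_self abs_mult abs_ge_zero less_imp_le mult_left_mono order_trans)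
        then have "a * W n \<omega> \<le> a * y + \<delta> / 2" using a\<epsilon> by (simp add: algebra_simps)
        then have "real n * a * W n \<omega> \<le> real n * (a * y + \<delta> / 2)"
          by (simp add: mult.assoc mult_left_mono)
        then show ?thesis using 1 \<omega> by simp
      next
        case 2
        then have "0 \<le> real n * t * (W n \<omega> - (y + \<epsilon>))" using t by simp
        then have "real n * a * W n \<omega> \<le> - real n * t * (y + \<epsilon>) + real n * (a + t) * W n \<omega>"
          by (simp add: algebra_simps)
        then show ?thesis by (simp only: exp_add[symmetric] exp_le_cancel_iff) blast
      next
        case 3
        then have "0 \<le> real n * t * ((y - \<epsilon>) - W n \<omega>)" using t by simp
        then have "real n * a * W n \<omega> \<le> real n * t * (y - \<epsilon>) + real n * (a - t) * W n \<omega>"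
          by (simp add: algebra_simps)
        then show ?thesis by (simp only: exp_add[symmetric] exp_le_cancel_iff) blast
      qed
      with nonneg show "?E a \<omega> \<le> indicator ?B \<omega> * ?c1 + ?c2 * ?E (a + t) \<omega> + ?c3 * ?E (a - t) \<omega>"
        by linarith
    qed
    also have "\<dots> = prob ?B * ?c1 + ?c2 * mgf (a + t) n + ?c3 * mgf (a - t) n"
      using int exp_W_integrable[OF elim(6)] by (simp add: mgf_def)
    finally have main: "mgf a n \<le> prob ?B * ?c1 + ?c2 * mgf (a + t) n + ?c3 * mgf (a - t) n" .
    have c2: "?c2 * mgf (a + t) n \<le> exp (real n * (L a - 4 * \<eta>))"
    proof -
      have "?c2 * mgf (a + t) n \<le> ?c2 * exp (real n * (L a + t * y + t * \<epsilon> / 2))"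
        using elim(2) by (intro mult_left_mono) auto
      also have "\<dots> = exp (real n * (L a - t * \<epsilon> / 2))"
        by (simp add: exp_add[symmetric] algebra_simps)
      also have "\<dots> \<le> exp (real n * (L a - 4 * \<eta>))"
        using \<eta>(2) by (simp add: mult_left_mono)
      finally show ?thesis .
    qed
    have c3: "?c3 * mgf (a - t) n \<le> exp (real n * (L a - 4 * \<eta>))"
    proof -
      have "?c3 * mgf (a - t) n \<le> ?c3 * exp (real n * (L a - t * y + t * \<epsilon> / 2))"
        using elim(3) by (intro mult_left_mono) auto
      also have "\<dots> = exp (real n * (L a - t * \<epsilon> / 2))"
        by (simp add: exp_add[symmetric] algebra_simps)
      also have "\<dots> \<le> exp (real n * (L a - 4 * \<eta>))"
        using \<eta>(2) by (simp add: mult_left_mono)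
      finally show ?thesis .
    qed
    \<comment> \<open>Each tail takes at most a quarter of the lower bound for
      \<open>mgf a n\<close>, so at least half of it comes from the ball.\<close>
    have "exp (real n * (L a - 4 * \<eta>)) = exp (real n * (-3 * \<eta>)) * exp (real n * (L a - \<eta>))"
      by (simp add: exp_add[symmetric] algebra_simps)
    also have "\<dots> \<le> 1 / 4 * exp (real n * (L a - \<eta>))"
      using elim(4) by (intro mult_right_mono) auto
    finally have "prob ?B * ?c1 \<ge> exp (real n * (L a - \<eta>)) / 2"
      using main elim(1) c2 c3 by linarith
    \<comment> \<open>One \<open>\<delta> / 4\<close> absorbs the factor 1/2, another absorbs
      \<open>\<eta>\<close>.\<close>
    moreover have "exp (real n * (L a - \<eta>)) / 2 \<ge> exp (real n * (L a - \<delta> / 2))"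
    proof -
      have "exp (real n * (L a - \<delta> / 2)) = exp (real n * (- \<delta> / 4)) * exp (real n * (L a - \<delta> / 4))"
        by (simp add: exp_add[symmetric] algebra_simps)
      also have "\<dots> \<le> 1 / 2 * exp (real n * (L a - \<eta>))"
        using elim(5) \<eta>(3) by (intro mult_mono) (auto intro!: mult_left_mono)
      finally show ?thesis by simp
    qed
    moreover have "exp (real n * (L a - \<delta> / 2)) = exp (real n * (L a - a * y - \<delta>)) * ?c1"
      by (simp add: exp_add[symmetric] algebra_simps)
    ultimately have "exp (real n * (L a - a * y - \<delta>)) * ?c1 \<le> prob ?B * ?c1" by linarith
    then have "exp (real n * (L a - a * y - \<delta>)) \<le> prob ?B" by simp
    also have "\<dots> \<le> \<P>(\<omega> in M. \<bar>W n \<omega> - y\<bar> < e)"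
      using \<epsilon>(2) by (intro finite_measure_mono) auto
    finally show ?case .
  qed
qed

text \<open>Every ball around \<open>y\<close> has positive probability for large \<open>n\<close>,
  so \<open>y\<close> is arbitrarily close to values of \<open>W n\<close>.\<close>

lemma derivative_bounded:
  assumes "(L has_real_derivative y) (at a)"
  shows "\<bar>y\<bar> \<le> A"
proof (rule field_le_epsilon)
  fix e :: real assume "e > 0"
  then have "\<forall>\<^sub>F n in sequentially. \<P>(\<omega> in M. \<bar>W n \<omega> - y\<bar> < e) \<ge> exp (real n * (L a - a * y - 1))"
    by (intro eventually_prob_ball_ge[OF assms]) auto
  then obtain n where n: "n \<ge> 1" "\<P>(\<omega> in M. \<bar>W n \<omega> - y\<bar> < e) \<ge> exp (real n * (L a - a * y - 1))"
    using eventually_happens'[OF sequentially_bot, OF eventually_conj[OF eventually_ge_at_top[of 1]]]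
    by blast
  then have "\<P>(\<omega> in M. \<bar>W n \<omega> - y\<bar> < e) > 0" by (meson exp_gt_zero less_le_trans)
  then have "{\<omega> \<in> space M. \<bar>W n \<omega> - y\<bar> < e} \<noteq> {}" by (metis less_irrefl measure_empty)
  then obtain \<omega> where "\<omega> \<in> space M" "\<bar>W n \<omega> - y\<bar> < e" by auto
  with W_bounded[OF n(1)] show "\<bar>y\<bar> \<le> A + e" by fastforce
qed

end


section \<open>Guesswork with decreasing success probabilities\<close>

text \<open>\<open>L\<close> is defined by \<open>lim\<close> at every order but convergence is
  supposed only above -1; at the other orders it has to be derived before \<open>L\<close> has a
  meaning there.\<close>

locale antitone_guesswork = prob_space +
  fixes Z :: "nat \<Rightarrow> 'a \<Rightarrow> nat" and m :: nat and L :: "real \<Rightarrow> real"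
  assumes Z_measurable: "\<And>n. n \<ge> 1 \<Longrightarrow> Z n \<in> M \<rightarrow>\<^sub>M count_space UNIV"
    and Z_range: "\<And>n \<omega>. n \<ge> 1 \<Longrightarrow> \<omega> \<in> space M \<Longrightarrow> Z n \<omega> \<in> {1..m ^ n}"
    and Z_antitone: "\<And>n j k. n \<ge> 1 \<Longrightarrow> 1 \<le> j \<Longrightarrow> j \<le> k \<Longrightarrow> k \<le> m ^ n \<Longrightarrow>
          \<P>(\<omega> in M. Z n \<omega> = k) \<le> \<P>(\<omega> in M. Z n \<omega> = j)"
    and cgf_convergent: "\<And>a. a > -1 \<Longrightarrow>
          convergent (\<lambda>n. ln (expectation (\<lambda>\<omega>. real (Z n \<omega>) powr a)) / real n)"
    and L_lim: "\<And>a. L a = lim (\<lambda>n. ln (expectation (\<lambda>\<omega>. real (Z n \<omega>) powr a)) / real n)"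
begin

section \<open>Point masses and moments of the guess number\<close>

definition p :: "nat \<Rightarrow> nat \<Rightarrow> real" where
  "p n k = \<P>(\<omega> in M. Z n \<omega> = k)"

definition moment :: "real \<Rightarrow> nat \<Rightarrow> real" where
  "moment a n = expectation (\<lambda>\<omega>. real (Z n \<omega>) powr a)"

lemma p_nonneg: "p n k \<ge> 0"
  by (simp add: p_def)

lemma p_antitone: "n \<ge> 1 \<Longrightarrow> 1 \<le> j \<Longrightarrow> j \<le> k \<Longrightarrow> k \<le> m ^ n \<Longrightarrow> p n k \<le> p n j"
  unfolding p_def by (rule Z_antitone)

lemma m_ge_1: "m \<ge> 1"
proof -
  obtain \<omega> where "\<omega> \<in> space M" using not_empty by auto
  from Z_range[OF order_refl this] show ?thesis by simp
qed

lemma prob_Z_mem: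
  assumes "n \<ge> 1" "finite S"
  shows "\<P>(\<omega> in M. Z n \<omega> \<in> S) = (\<Sum>k\<in>S. p n k)"
proof -
  have [measurable]: "Z n \<in> M \<rightarrow>\<^sub>M count_space UNIV" by (rule Z_measurable[OF assms(1)])
  have "{\<omega> \<in> space M. Z n \<omega> \<in> S} = (\<Union>k\<in>S. {\<omega> \<in> space M. Z n \<omega> = k})" by auto
  then have "\<P>(\<omega> in M. Z n \<omega> \<in> S) = prob (\<Union>k\<in>S. {\<omega> \<in> space M. Z n \<omega> = k})" by simp
  also have "\<dots> = (\<Sum>k\<in>S. prob {\<omega> \<in> space M. Z n \<omega> = k})"
    by (rule finite_measure_finite_Union) (auto simp: assms(2) disjoint_family_on_def)
  finally show ?thesis by (simp add: p_def)
qed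

lemma moment_eq_sum:
  assumes "n \<ge> 1"
  shows "moment a n = (\<Sum>k=1..m ^ n. real k powr a * p n k)"
proof -
  have [measurable]: "Z n \<in> M \<rightarrow>\<^sub>M count_space UNIV" by (rule Z_measurable[OF assms])
  have "moment a n = (\<integral>\<omega>. (\<Sum>k=1..m ^ n. real k powr a * indicator {\<omega> \<in> space M. Z n \<omega> = k} \<omega>) \<partial>M)"
    unfolding moment_def
  proof (rule Bochner_Integration.integral_cong)
    fix \<omega> assume \<omega>: "\<omega> \<in> space M"
    have "(\<Sum>k=1..m ^ n. real k powr a * indicator {\<omega> \<in> space M. Z n \<omega> = k} \<omega>)
        = (\<Sum>k\<in>{Z n \<omega>}. real k powr a * indicator {\<omega> \<in> space M. Z n \<omega> = k} \<omega>)"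
      using Z_range[OF assms \<omega>] by (intro sum.mono_neutral_right) (auto simp: indicator_def)
    then show "real (Z n \<omega>) powr a
        = (\<Sum>k=1..m ^ n. real k powr a * indicator {\<omega> \<in> space M. Z n \<omega> = k} \<omega>)"
      using \<omega> by simp
  qed simp
  also have "\<dots> = (\<Sum>k=1..m ^ n. \<integral>\<omega>. real k powr a * indicator {\<omega> \<in> space M. Z n \<omega> = k} \<omega> \<partial>M)"
    by (intro Bochner_Integration.integral_sum integrable_mult_right integrable_real_indicator)
      (simp_all add: emeasure_eq_measure)
  also have "\<dots> = (\<Sum>k=1..m ^ n. real k powr a * p n k)"
    by (simp add: p_def)
  finally show ?thesis .
qed

lemma p_1_le_moment:
  assumes "n \<ge> 1"
  shows "p n 1 \<le> moment a n"
proof -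
  have "(\<Sum>k\<in>{1}. real k powr a * p n k) \<le> (\<Sum>k=1..m ^ n. real k powr a * p n k)"
    using m_ge_1 by (intro sum_mono2) (auto simp: p_nonneg)
  then show ?thesis by (simp add: moment_eq_sum[OF assms])
qed

text \<open>The masses add up to 1 and the first is the largest.\<close>

lemma p_1_pos:
  assumes "n \<ge> 1"
  shows "p n 1 > 0"
proof -
  have "1 = \<P>(\<omega> in M. Z n \<omega> \<in> {1..m ^ n})"
    using Z_range[OF assms] by (simp add: prob_space cong: conj_cong)
  also have "\<dots> = (\<Sum>k=1..m ^ n. p n k)" by (intro prob_Z_mem assms) simp
  also have "\<dots> \<le> (\<Sum>k=1..m ^ n. p n 1)"
    using p_antitone[OF assms] by (intro sum_mono) auto
  finally show ?thesis using p_nonneg[of n 1] by (cases "p n 1 = 0") auto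
qed

text \<open>Each mass is at most \<open>p n 1\<close>. Splitting \<open>k powr a\<close> into
  \<open>k powr (a + 1)\<close> and \<open>1 / k\<close> leaves a harmonic sum, which is only linear
  in \<open>n\<close>.\<close>

lemma moment_le_p_1:
  assumes "n \<ge> 1"
  shows "moment a n \<le> p n 1 * ((1 + real n * ln m) * exp (real n * (max (a + 1) 0 * ln m)))"
proof -
  let ?b = "max (a + 1) 0"
  have "moment a n \<le> (\<Sum>k=1..m ^ n. (real m ^ n) powr ?b * inverse (real k) * p n 1)"
    unfolding moment_eq_sum[OF assms]
  proof (intro sum_mono mult_mono p_antitone assms)
    fix k assume k: "k \<in> {1..m ^ n}"
    then have kp: "real k \<ge> 1" "real k \<le> real m ^ n" by (simp_all flip: of_nat_power)
    have "real k powr a = real k powr (a + 1) * inverse (real k)"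
      using kp by (simp add: powr_add field_simps)
    also have "\<dots> \<le> real k powr ?b * inverse (real k)"
      using kp by (intro mult_right_mono powr_mono) auto
    also have "\<dots> \<le> (real m ^ n) powr ?b * inverse (real k)"
      using kp by (intro mult_right_mono powr_mono2) auto
    finally show "real k powr a \<le> (real m ^ n) powr ?b * inverse (real k)" .
  qed (auto simp: p_nonneg)
  also have "\<dots> = p n 1 * (harm (m ^ n) * (real m ^ n) powr ?b)"
    by (simp add: harm_def sum_distrib_left sum_distrib_right mult_ac)
  also have "\<dots> \<le> p n 1 * ((1 + real n * ln m) * (real m ^ n) powr ?b)"
  proof (intro mult_left_mono mult_right_mono p_nonneg powr_ge_zero)
    \<comment> \<open>The difference between harmonic number and logarithm decreases from its value
      1 at 1.\<close>
    have "harm (m ^ n) - ln (of_nat (m ^ n)) \<le> harm 1 - ln (of_nat 1 :: real)"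
      using m_ge_1 by (intro euler_mascheroni_sequence_decreasing) auto
    then show "harm (m ^ n) \<le> 1 + real n * ln m"
      using m_ge_1 by (simp add: harm_expand ln_realpow)
  qed
  also have "(real m ^ n) powr ?b = exp (real n * (?b * ln m))"
    using m_ge_1 by (simp add: powr_def ln_realpow)
  finally show ?thesis .
qed

section \<open>The rate of a correct first guess, and orders up to -1\<close>

definition scaled_log_p_1 :: "nat \<Rightarrow> real" where
  "scaled_log_p_1 n = ln (p n 1) / real n"

text \<open>This is minus the min-entropy rate \<open>H_\<infinity>(X|Y)\<close>.\<close>

definition h :: real where
  "h = lim scaled_log_p_1"

lemma ln_m_nonneg: "ln (real m) \<ge> 0"
  using m_ge_1 by simp

lemma scaled_log_p_1_le:
  assumes "n \<ge> 1"
  shows "scaled_log_p_1 n \<le> ln (moment a n) / real n"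
  unfolding scaled_log_p_1_def
  using p_1_le_moment[OF assms, of a] p_1_pos[OF assms] by (intro divide_right_mono) auto

lemma scaled_log_moment_le:
  assumes "n \<ge> 1"
  shows "ln (moment a n) / real n
      \<le> scaled_log_p_1 n + ln (1 + real n * ln m) / real n + max (a + 1) 0 * ln m"
proof -
  have pos: "p n 1 > 0" "moment a n > 0" "1 + real n * ln m > 0"
    using p_1_pos[OF assms] p_1_le_moment[OF assms, of a] ln_m_nonneg
    by (auto intro: add_pos_nonneg)
  have "ln (moment a n)
      \<le> ln (p n 1 * ((1 + real n * ln m) * exp (real n * (max (a + 1) 0 * ln m))))"
    using moment_le_p_1[OF assms, of a] pos by simp
  also have "\<dots> = ln (p n 1) + (ln (1 + real n * ln m) + real n * (max (a + 1) 0 * ln m))"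
    using pos by (simp add: ln_mult)
  finally show ?thesis
    using assms by (simp add: scaled_log_p_1_def field_simps)
qed

lemma log_correction_tendsto: "(\<lambda>n. ln (1 + real n * ln m) / real n) \<longlonglongrightarrow> 0"
proof (cases "ln (real m) = 0")
  case False
  then have "ln (real m) > 0" using ln_m_nonneg by simp
  then show ?thesis by real_asymp
qed simp

text \<open>For \<open>a > -1\<close> the logarithmic rate of \<open>p n 1\<close> is asymptotically within \<open>(a + 1) ln m\<close> of that of
  the moment of order \<open>a\<close>, which converges; letting \<open>a \<rightarrow> -1+\<close> makes it a Cauchy sequence.\<close>

lemma scaled_log_p_1_tendsto: "scaled_log_p_1 \<longlonglongrightarrow> h"
proof -
  have "Cauchy scaled_log_p_1"
  proof (rule metric_CauchyI)
    fix e :: real assume e: "e > 0"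
    \<comment> \<open>Adding 1 keeps the divisor positive when \<open>m = 1\<close>. The order
      \<open>a\<close> is then so close to -1 that \<open>(a + 1) * ln m\<close> is at most
      \<open>e / 4\<close>.\<close>
    define c where "c = ln (real m) + 1"
    define a where "a = - 1 + e / (4 * c)"
    have c: "c > 0" "ln m \<le> c" using ln_m_nonneg by (simp_all add: c_def)
    then have a: "a > - 1" using e c by (simp add: a_def)
    have "(a + 1) * ln m \<le> (a + 1) * c" using a c by (intro mult_left_mono) auto
    also have "\<dots> = e / 4" using c by (simp add: a_def)
    finally have small: "max (a + 1) 0 * ln m \<le> e / 4" using a by simp
    have "Cauchy (\<lambda>n. ln (moment a n) / real n)"
      using cgf_convergent[OF a] by (simp add: Cauchy_convergent_iff moment_def)
    then obtain N1 where N1: "\<And>i j. i \<ge> N1 \<Longrightarrow> j \<ge> N1 \<Longrightarrow>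
        dist (ln (moment a i) / real i) (ln (moment a j) / real j) < e / 4"
      using metric_CauchyD[of "\<lambda>n. ln (moment a n) / real n" "e / 4"] e by auto
    have "\<forall>\<^sub>F n in sequentially. ln (1 + real n * ln m) / real n < e / 8"
      using e by (intro order_tendstoD(2)[OF log_correction_tendsto]) simp
    then obtain N2 where N2: "\<And>n. n \<ge> N2 \<Longrightarrow> ln (1 + real n * ln m) / real n < e / 8"
      by (auto simp: eventually_sequentially)
    \<comment> \<open>The error is \<open>e / 4\<close> from the order and \<open>e / 8\<close> from
      the logarithmic correction; two such errors and the \<open>e / 4\<close> of the moments add up
      to \<open>e\<close>.\<close>
    have close: "\<bar>scaled_log_p_1 n - ln (moment a n) / real n\<bar> \<le> 3 * e / 8"
      if "n \<ge> max N2 1" for n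
    proof -
      have "n \<ge> 1" "n \<ge> N2" using that by simp_all
      with scaled_log_p_1_le[of n a] scaled_log_moment_le[of n a] N2[of n] small e
      show ?thesis unfolding abs_le_iff by linarith
    qed
    show "\<exists>N. \<forall>i\<ge>N. \<forall>j\<ge>N. dist (scaled_log_p_1 i) (scaled_log_p_1 j) < e"
    proof (intro exI[of _ "max N1 (max N2 1)"] allI impI)
      fix i j assume "i \<ge> max N1 (max N2 1)" "j \<ge> max N1 (max N2 1)"
      then show "dist (scaled_log_p_1 i) (scaled_log_p_1 j) < e"
        using N1[of i j] close[of i] close[of j] e unfolding dist_real_def by linarith
    qed
  qed
  then show ?thesis
    by (simp add: h_def convergent_LIMSEQ_iff Cauchy_convergent_iff)
qed

text \<open>From -1 downwards the term \<open>max (a + 1) 0\<close> vanishes, and only the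
  logarithmic correction separates the two rates.\<close>

lemma moment_tendsto_h:
  assumes "a \<le> - 1"
  shows "(\<lambda>n. ln (moment a n) / real n) \<longlonglongrightarrow> h"
proof (rule tendsto_sandwich)
  show "scaled_log_p_1 \<longlonglongrightarrow> h" by (rule scaled_log_p_1_tendsto)
  show "(\<lambda>n. scaled_log_p_1 n + ln (1 + real n * ln m) / real n) \<longlonglongrightarrow> h"
    using tendsto_add[OF scaled_log_p_1_tendsto log_correction_tendsto] by simp
  show "\<forall>\<^sub>F n in sequentially. scaled_log_p_1 n \<le> ln (moment a n) / real n"
    using eventually_ge_at_top[of 1] by eventually_elim (rule scaled_log_p_1_le)
  show "\<forall>\<^sub>F n in sequentially. ln (moment a n) / real n
      \<le> scaled_log_p_1 n + ln (1 + real n * ln m) / real n"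
    using eventually_ge_at_top[of 1]
  proof eventually_elim
    case (elim n)
    have "max (a + 1) 0 = 0" using assms by simp
    with scaled_log_moment_le[OF elim, of a] show ?case by simp
  qed
qed

lemma L_eq_h: "a \<le> - 1 \<Longrightarrow> L a = h"
  using moment_tendsto_h[of a] by (simp add: L_lim moment_def limI)

lemma moment_tendsto: "(\<lambda>n. ln (moment a n) / real n) \<longlonglongrightarrow> L a"
proof (cases "a \<le> - 1")
  case True
  then show ?thesis using moment_tendsto_h L_eq_h by simp
next
  case False
  then show ?thesis
    using cgf_convergent[of a] by (simp add: L_lim moment_def convergent_LIMSEQ_iff)
qed

lemma L_ge_h: "L a \<ge> h"
  by (rule tendsto_le[OF _ moment_tendsto[of a] scaled_log_p_1_tendsto])
    (auto intro!: eventually_mono[OF eventually_ge_at_top[of 1]] scaled_log_p_1_le)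

section \<open>The normalised logarithm of the guess number\<close>

definition W :: "nat \<Rightarrow> 'a \<Rightarrow> real" where
  "W n \<omega> = ln (real (Z n \<omega>)) / real n"

lemma bounded_cgf_W: "bounded_cgf M W (ln m) L"
proof
  fix n :: nat assume n: "n \<ge> 1"
  have [measurable]: "Z n \<in> M \<rightarrow>\<^sub>M count_space UNIV" by (rule Z_measurable[OF n])
  show "W n \<in> borel_measurable M" unfolding W_def by measurable
  fix \<omega> assume \<omega>: "\<omega> \<in> space M"
  have Z: "1 \<le> real (Z n \<omega>)" "real (Z n \<omega>) \<le> real m ^ n"
    using Z_range[OF n \<omega>] by (simp_all flip: of_nat_power)
  then have "ln (real (Z n \<omega>)) \<le> ln (real m ^ n)"
    using ln_le_cancel_iff[of "real (Z n \<omega>)" "real m ^ n"] by linarith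
  then have "ln (real (Z n \<omega>)) \<le> real n * ln m"
    using m_ge_1 by (simp add: ln_realpow)
  then show "\<bar>W n \<omega>\<bar> \<le> ln m"
    using Z n by (simp add: W_def field_simps)
next
  fix a
  have "\<forall>\<^sub>F n in sequentially. ln (moment a n) / real n
      = ln (expectation (\<lambda>\<omega>. exp (real n * a * W n \<omega>))) / real n"
    using eventually_ge_at_top[of 1]
  proof eventually_elim
    case (elim n)
    have "moment a n = expectation (\<lambda>\<omega>. exp (real n * a * W n \<omega>))"
      unfolding moment_def
    proof (rule Bochner_Integration.integral_cong)
      fix \<omega> assume "\<omega> \<in> space M"
      then show "real (Z n \<omega>) powr a = exp (real n * a * W n \<omega>)"
        using Z_range[OF elim] elim by (force simp: powr_def W_def)
    qed simp
    then show ?case by simp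
  qed
  from Lim_transform_eventually[OF moment_tendsto this]
  show "(\<lambda>n. ln (expectation (\<lambda>\<omega>. exp (real n * a * W n \<omega>))) / real n) \<longlonglongrightarrow> L a" .
qed

sublocale bounded_cgf M W "ln m" L
  by (rule bounded_cgf_W)

lemma W_measurable_set:
  assumes "n \<ge> 1" "S \<in> sets borel"
  shows "{\<omega> \<in> space M. W n \<omega> \<in> S} \<in> sets M"
  using W_measurable[OF assms(1)] assms(2) by measurable

text \<open>A lower bound for \<open>p n k\<close> with \<open>k\<close> near \<open>exp (n y)\<close>, \<open>y = L' a\<close>, propagates to all smaller
  \<open>k\<close> by monotonicity. As \<open>a \<rightarrow> -1+\<close> it becomes \<open>exp (n h)\<close>, so that the mass near
  \<open>exp (n x)\<close>, \<open>x < y\<close>, is at least about \<open>exp (n (x + h))\<close>.\<close>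

lemma eventually_p_ge:
  assumes deriv: "\<And>a. a > - 1 \<Longrightarrow> (L has_real_derivative D a) (at a)"
    and less: "\<And>a. a > - 1 \<Longrightarrow> x < D a"
    and x: "x \<ge> 0" and \<delta>: "\<delta> > 0"
  shows "\<forall>\<^sub>F n in sequentially. p n (nat \<lfloor>exp (real n * x)\<rfloor>) \<ge> exp (real n * (h - \<delta>))"
proof -
  define c where "c = ln (real m) + 1"
  \<comment> \<open>Since \<open>y\<close> is at most \<open>ln m\<close>, hence at most
    \<open>c\<close>, this gives \<open>(a + 1) * y \<le> \<delta> / 3\<close>.\<close>
  define a where "a = - 1 + \<delta> / (3 * c)"
  define y where "y = D a"
  have c: "c > 0" "ln m \<le> c" using ln_m_nonneg by (simp_all add: c_def)
  then have a: "a > - 1" using \<delta> c by (simp add: a_def)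
  have y: "x < y" "\<bar>y\<bar> \<le> ln m"
    using less[OF a] derivative_bounded[OF deriv[OF a]] by (auto simp: y_def)
  have "(a + 1) * y \<le> (a + 1) * c" using a c y by (intro mult_left_mono) auto
  also have "\<dots> = \<delta> / 3" using c by (simp add: a_def)
  finally have ay: "(a + 1) * y \<le> \<delta> / 3" .
  \<comment> \<open>The first bound keeps the ball around \<open>y\<close> above \<open>x\<close>,
    the second is one third of the error allowed.\<close>
  define \<eta> where "\<eta> = min (y - x) (\<delta> / 3)"
  have \<eta>: "\<eta> > 0" "\<eta> \<le> y - x" "\<eta> \<le> \<delta> / 3"
    using y \<delta> unfolding \<eta>_def by (simp_all del: min_divide_distrib_right le_divide_eq_numeral1)
  have "\<forall>\<^sub>F n in sequentially. \<P>(\<omega> in M. \<bar>W n \<omega> - y\<bar> < \<eta>) \<ge> exp (real n * (L a - a * y - \<delta> / 3))"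
    using eventually_prob_ball_ge[OF deriv[OF a] \<eta>(1), of "\<delta> / 3"] \<delta> by (simp add: y_def)
  then show ?thesis using eventually_ge_at_top[of 1]
  proof eventually_elim
    case (elim n)
    let ?K = "nat \<lfloor>exp (real n * x)\<rfloor>"
    let ?S = "{k. ?K \<le> k \<and> k \<le> m ^ n \<and> real k < exp (real n * (y + \<eta>)) \<and> k \<ge> 1}"
    have S: "finite ?S" by (rule finite_subset[of _ "{..m ^ n}"]) auto
    have "{\<omega> \<in> space M. \<bar>W n \<omega> - y\<bar> < \<eta>} \<subseteq> {\<omega> \<in> space M. Z n \<omega> \<in> ?S}"
    proof (safe, goal_cases)
      case (1 \<omega>)
      then have "W n \<omega> > x" using \<eta> by linarith
      then have "real n * x < ln (real (Z n \<omega>))" using elim(2) by (simp add: W_def field_simps)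
      then have "exp (real n * x) < real (Z n \<omega>)"
        using Z_range[OF elim(2) 1(1)]
        by (metis atLeastAtMost_iff exp_less_cancel_iff exp_ln less_le_trans of_nat_0_less_iff zero_less_one)
      then show ?case by linarith
    next
      case (2 \<omega>)
      then show ?case using Z_range[OF elim(2)] by auto
    next
      case (3 \<omega>)
      then have "W n \<omega> < y + \<eta>" by linarith
      then have "ln (real (Z n \<omega>)) < real n * (y + \<eta>)" using elim(2) by (simp add: W_def field_simps)
      then show ?case
        using Z_range[OF elim(2) 3(1)]
        by (metis atLeastAtMost_iff exp_less_cancel_iff exp_ln less_le_trans of_nat_0_less_iff zero_less_one)
    next
      case (4 \<omega>)
      then show ?case using Z_range[OF elim(2)] by auto
    qed
    then have "\<P>(\<omega> in M. \<bar>W n \<omega> - y\<bar> < \<eta>) \<le> \<P>(\<omega> in M. Z n \<omega> \<in> ?S)"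
      using Z_measurable[OF elim(2)] by (intro finite_measure_mono) auto
    also have "\<dots> = (\<Sum>k\<in>?S. p n k)" by (rule prob_Z_mem[OF elim(2) S])
    \<comment> \<open>All of \<open>?S\<close> lies at or above \<open>?K\<close>, whose mass is
      therefore the largest.\<close>
    also have "\<dots> \<le> (\<Sum>k\<in>?S. p n ?K)"
    proof (rule sum_mono)
      fix k assume k: "k \<in> ?S"
      have "1 \<le> exp (real n * x)" using x by simp
      then have "1 \<le> ?K" by (simp add: le_nat_iff le_floor_iff)
      with k show "p n k \<le> p n ?K" by (intro p_antitone[OF elim(2)]) auto
    qed
    also have "\<dots> = real (card ?S) * p n ?K" by simp
    also have "\<dots> \<le> exp (real n * (y + \<eta>)) * p n ?K"
    proof (intro mult_right_mono p_nonneg)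
      have "?S \<subseteq> {1..nat \<lfloor>exp (real n * (y + \<eta>))\<rfloor>}" by (auto simp: le_nat_floor)
      then have "card ?S \<le> nat \<lfloor>exp (real n * (y + \<eta>))\<rfloor>"
        using card_mono[of "{1..nat \<lfloor>exp (real n * (y + \<eta>))\<rfloor>}" ?S] by simp
      then show "real (card ?S) \<le> exp (real n * (y + \<eta>))"
        by (simp add: le_nat_iff le_floor_iff)
    qed
    finally have "exp (real n * (L a - a * y - \<delta> / 3)) \<le> exp (real n * (y + \<eta>)) * p n ?K"
      using elim(1) by linarith
    then have "exp (real n * (L a - a * y - \<delta> / 3)) * exp (- (real n * (y + \<eta>)))
        \<le> exp (real n * (y + \<eta>)) * p n ?K * exp (- (real n * (y + \<eta>)))"
      by (rule mult_right_mono) simp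
    also have "\<dots> = p n ?K" by (simp add: exp_minus)
    finally have "exp (real n * (L a - a * y - \<delta> / 3)) * exp (- (real n * (y + \<eta>))) \<le> p n ?K" .
    moreover have "exp (real n * (h - \<delta>)) \<le> exp (real n * (L a - a * y - \<delta> / 3)) * exp (- (real n * (y + \<eta>)))"
    proof -
      \<comment> \<open>The three thirds of \<open>\<delta>\<close> pay for
        \<open>(a + 1) * y\<close>, for the ball estimate and for \<open>\<eta>\<close>.\<close>
      have "h - \<delta> \<le> L a - a * y - \<delta> / 3 - (y + \<eta>)"
        using L_ge_h[of a] ay \<eta>(3) by (simp add: algebra_simps)
      from mult_left_mono[OF this, of "real n"] show ?thesis
        by (simp add: exp_add[symmetric] right_diff_distrib)
    qed
    ultimately show ?case by linarith
  qed
qed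

text \<open>About \<open>exp (n x)\<close> integers \<open>k\<close> have \<open>ln k / n\<close>
  just below \<open>x\<close>, and each has mass at least about \<open>exp (n h)\<close>. At
  \<open>x = 0\<close> this block of integers degenerates, and the single value 1 does the
  work.\<close>

lemma eventually_prob_near_ge_flat:
  assumes deriv: "\<And>a. a > - 1 \<Longrightarrow> (L has_real_derivative D a) (at a)"
    and less: "\<And>a. a > - 1 \<Longrightarrow> x < D a"
    and x: "x \<ge> 0" and \<epsilon>: "\<epsilon> > 0" and \<delta>: "\<delta> > 0"
  shows "\<forall>\<^sub>F n in sequentially. \<P>(\<omega> in M. \<bar>W n \<omega> - x\<bar> < \<epsilon>) \<ge> exp (real n * (x + h - \<delta>))"
proof (cases "x = 0")
  case True
  have "\<forall>\<^sub>F n in sequentially. scaled_log_p_1 n > h - \<delta>"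
    using \<delta> by (intro order_tendstoD(1)[OF scaled_log_p_1_tendsto]) simp
  then show ?thesis using eventually_ge_at_top[of 1]
  proof eventually_elim
    case (elim n)
    then have "real n * (h - \<delta>) < ln (p n 1)" by (simp add: scaled_log_p_1_def field_simps)
    then have "exp (real n * (h - \<delta>)) \<le> p n 1"
      using p_1_pos[OF elim(2)] by (metis exp_less_cancel_iff exp_ln less_imp_le)
    also have "\<dots> \<le> \<P>(\<omega> in M. \<bar>W n \<omega> - x\<bar> < \<epsilon>)"
      unfolding p_def
    proof (rule finite_measure_mono)
      show "{\<omega> \<in> space M. Z n \<omega> = 1} \<subseteq> {\<omega> \<in> space M. \<bar>W n \<omega> - x\<bar> < \<epsilon>}"
        using \<epsilon> True by (auto simp: W_def)
      show "{\<omega> \<in> space M. \<bar>W n \<omega> - x\<bar> < \<epsilon>} \<in> sets M"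
        using W_measurable[OF elim(2)] by measurable
    qed
    finally show ?case by (simp add: True)
  qed
next
  case False
  then have x0: "x > 0" using x by simp
  define e where "e = min (\<epsilon> / 2) x"
  have e: "e > 0" "e < \<epsilon>" using x0 \<epsilon> by (auto simp: e_def)
  \<comment> \<open>This keeps \<open>?K\<close> below \<open>m ^ n\<close>, the range where the
    masses decrease.\<close>
  have "x < ln m"
    using less[of 0] derivative_bounded[OF deriv[of 0]] by simp
  have "\<forall>\<^sub>F n in sequentially. p n (nat \<lfloor>exp (real n * x)\<rfloor>) \<ge> exp (real n * (h - \<delta> / 2))"
    using \<delta> by (intro eventually_p_ge[OF deriv less x]) auto
  \<comment> \<open>The left side bounds the number of integers in the block from below; the 1 is
    the loss from rounding \<open>?K\<close> down. Each of the other three exponential terms is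
    eventually at most a third of \<open>exp (n x)\<close>.\<close>
  moreover have "\<forall>\<^sub>F n in sequentially. exp (real n * x) - exp (real n * (x - e)) - 1
      \<ge> exp (real n * (x - \<delta> / 2))"
  proof -
    have "\<forall>\<^sub>F n in sequentially. exp (real n * (- e)) \<le> 1 / 3"
      "\<forall>\<^sub>F n in sequentially. exp (real n * (- \<delta> / 2)) \<le> 1 / 3"
      "\<forall>\<^sub>F n in sequentially. exp (real n * (- x)) \<le> 1 / 3"
      using e(1) \<delta> x0 by real_asymp+
    then show ?thesis
    proof eventually_elim
      case (elim n)
      have "exp (real n * x) * (exp (real n * (- e)) + exp (real n * (- \<delta> / 2)) + exp (real n * (- x)))
          \<le> exp (real n * x) * 1"
        using elim by (intro mult_left_mono) auto
      then show ?case
        by (simp add: distrib_left exp_add[symmetric] right_diff_distrib)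
    qed
  qed
  ultimately show ?thesis using eventually_ge_at_top[of 1]
  proof eventually_elim
    case (elim n)
    let ?K = "nat \<lfloor>exp (real n * x)\<rfloor>" and ?J = "nat \<lfloor>exp (real n * (x - e))\<rfloor>"
    have K: "real ?K \<le> exp (real n * x)" "real ?K > exp (real n * x) - 1"
      by (simp_all add: le_floor_iff)
    have J: "real ?J \<le> exp (real n * (x - e))" "real ?J > exp (real n * (x - e)) - 1"
      by (simp_all add: le_floor_iff)
    have Km: "?K \<le> m ^ n"
    proof -
      have "real ?K \<le> exp (real n * ln m)"
        using K(1) \<open>x < ln m\<close> by (meson exp_le_cancel_iff less_imp_le mult_left_mono of_nat_0_le_iff order_trans)
      also have "\<dots> = real (m ^ n)" using m_ge_1 by (simp add: exp_of_nat_mult)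
      finally show ?thesis by linarith
    qed
    have "exp (real n * (x + h - \<delta>)) = exp (real n * (x - \<delta> / 2)) * exp (real n * (h - \<delta> / 2))"
      by (simp add: exp_add[symmetric] algebra_simps)
    also have "\<dots> \<le> (real ?K - real ?J) * p n ?K"
    proof (intro mult_mono elim(1) exp_ge_zero)
      show le: "exp (real n * (x - \<delta> / 2)) \<le> real ?K - real ?J"
        using elim(2) K(2) J(1) by linarith
      show "0 \<le> real ?K - real ?J" using exp_ge_zero le by (rule order_trans)
    qed
    also have "\<dots> \<le> (\<Sum>k\<in>{?J<..?K}. p n ?K)"
    proof -
      have "real i - real j \<le> real (i - j)" for i j :: nat by linarith
      then show ?thesis by (simp only: sum_constant card_greaterThanAtMost mult_right_mono p_nonneg)
    qed
    also have "\<dots> \<le> (\<Sum>k\<in>{?J<..?K}. p n k)"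
      using Km by (intro sum_mono p_antitone[OF elim(3)]) auto
    also have "\<dots> = \<P>(\<omega> in M. Z n \<omega> \<in> {?J<..?K})"
      by (rule prob_Z_mem[OF elim(3), symmetric]) simp
    also have "\<dots> \<le> \<P>(\<omega> in M. \<bar>W n \<omega> - x\<bar> < \<epsilon>)"
    proof (rule finite_measure_mono)
      show "{\<omega> \<in> space M. \<bar>W n \<omega> - x\<bar> < \<epsilon>} \<in> sets M"
        using W_measurable[OF elim(3)] by measurable
      show "{\<omega> \<in> space M. Z n \<omega> \<in> {?J<..?K}} \<subseteq> {\<omega> \<in> space M. \<bar>W n \<omega> - x\<bar> < \<epsilon>}"
      proof safe
        fix \<omega> assume "\<omega> \<in> space M" and Z: "Z n \<omega> \<in> {?J<..?K}"
        then have pos: "real (Z n \<omega>) > 0" and "real (Z n \<omega>) \<le> real ?K"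
          by (auto simp del: of_nat_nat)
        then have le: "real (Z n \<omega>) \<le> exp (real n * x)" using K(1) by linarith
        have "real (Z n \<omega>) \<ge> real ?J + 1" using Z by auto
        then have "exp (real n * (x - e)) < real (Z n \<omega>)" using J(2) by linarith
        then have "real n * (x - e) < ln (real (Z n \<omega>))" "ln (real (Z n \<omega>)) \<le> real n * x"
          using pos le by (metis exp_less_cancel_iff exp_ln, metis exp_le_cancel_iff exp_ln)
        then have "x - e < W n \<omega>" "W n \<omega> \<le> x"
          using elim(3) by (simp_all add: W_def field_simps)
        then show "\<bar>W n \<omega> - x\<bar> < \<epsilon>" using e by linarith
      qed
    qed
    finally show ?case .
  qed
qed

text \<open>\<open>B\<close> is any upper bound of \<open>L\<^sup>* x\<close>. Points attained by \<open>D\<close> are exposed and come from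
  tilting; points above the range of \<open>D\<close> have \<open>L\<^sup>* x = \<infinity>\<close> unless they are limits of attained ones;
  on the points below the range of \<open>D\<close>, \<open>L\<^sup>*\<close> is the affine function \<open>x \<mapsto> - x - h\<close>, and no
  tilting reaches them.\<close>

lemma eventually_prob_near_ge:
  assumes deriv: "\<And>a. a > - 1 \<Longrightarrow> (L has_real_derivative D a) (at a)"
    and cont: "continuous_on {- 1<..} D"
    and B: "\<And>a. x * a - L a \<le> B"
    and \<epsilon>: "\<epsilon> > 0" and \<delta>: "\<delta> > 0"
  shows "\<forall>\<^sub>F n in sequentially. \<P>(\<omega> in M. \<bar>W n \<omega> - x\<bar> < \<epsilon>) \<ge> exp (real n * (- B - \<delta>))"
proof -
  \<comment> \<open>For negative \<open>x\<close> the transform is infinite, because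
    \<open>L\<close> is constant on the orders up to -1; the \<open>a\<close> below is negative
    enough to exceed \<open>B\<close>.\<close>
  have x: "x \<ge> 0"
  proof (rule ccontr)
    assume "\<not> x \<ge> 0"
    then have "x < 0" by simp
    define a where "a = (\<bar>B + h\<bar> + 1) / x - 1"
    have "a \<le> - 1" using \<open>x < 0\<close> by (simp add: a_def divide_nonneg_neg)
    moreover have "x * a = - x + \<bar>B + h\<bar> + 1" using \<open>x < 0\<close> by (simp add: a_def field_simps)
    ultimately show False using B[of a] L_eq_h[of a] \<open>x < 0\<close> by linarith
  qed
  have "- x - h \<le> B" using B[of "- 1"] L_eq_h[of "- 1"] by simp
  \<comment> \<open>It suffices that \<open>D a\<close> is slightly below \<open>x\<close>: as
    \<open>a > - 1\<close>, moving from \<open>D a\<close> to \<open>x\<close> costs at most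
    \<open>x - D a < \<delta> / 2\<close> in the exponent.\<close>
  have exposed: ?thesis if a: "a > - 1" "x - min (\<epsilon> / 2) (\<delta> / 2) < D a" "D a \<le> x" for a
  proof -
    let ?y = "D a"
    have "\<forall>\<^sub>F n in sequentially.
        \<P>(\<omega> in M. \<bar>W n \<omega> - ?y\<bar> < \<epsilon> / 2) \<ge> exp (real n * (L a - a * ?y - \<delta> / 2))"
      using \<epsilon> \<delta> by (intro eventually_prob_ball_ge deriv a) auto
    then show ?thesis using eventually_ge_at_top[of 1]
    proof eventually_elim
      case (elim n)
      have "a * (x - ?y) \<ge> - 1 * (x - ?y)" using a by (intro mult_right_mono) auto
      then have "- B - \<delta> \<le> L a - a * ?y - \<delta> / 2"
        using B[of a] a(2) by (simp add: algebra_simps)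
      then have "exp (real n * (- B - \<delta>)) \<le> exp (real n * (L a - a * ?y - \<delta> / 2))"
        by (simp add: mult_left_mono)
      also have "\<dots> \<le> \<P>(\<omega> in M. \<bar>W n \<omega> - ?y\<bar> < \<epsilon> / 2)" by (rule elim(1))
      also have "\<dots> \<le> \<P>(\<omega> in M. \<bar>W n \<omega> - x\<bar> < \<epsilon>)"
      proof (rule finite_measure_mono)
        show "{\<omega> \<in> space M. \<bar>W n \<omega> - ?y\<bar> < \<epsilon> / 2} \<subseteq> {\<omega> \<in> space M. \<bar>W n \<omega> - x\<bar> < \<epsilon>}"
          using a(2,3) by (intro Collect_mono) linarith
        show "{\<omega> \<in> space M. \<bar>W n \<omega> - x\<bar> < \<epsilon>} \<in> sets M"
          using W_measurable[OF elim(2)] by measurable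
      qed
      finally show ?case .
    qed
  qed
  \<comment> \<open>A continuous image of an interval is an interval, so a point outside it lies
    wholly to one side.\<close>
  consider "\<forall>a>-1. x < D a" | "\<forall>a>-1. D a < x" | a where "a > - 1" "D a = x"
  proof -
    have "connected (D ` {- 1<..})" by (intro connected_continuous_image cont) simp
    then have "x \<in> D ` {- 1<..}" if "a > - 1" "b > - 1" "D a \<le> x" "x \<le> D b" for a b
      using that by (auto simp: connected_iff_interval)
    then show ?thesis using that by (metis greaterThan_iff imageE not_le)
  qed
  then show ?thesis
  proof cases
    case 1
    have "\<forall>\<^sub>F n in sequentially. \<P>(\<omega> in M. \<bar>W n \<omega> - x\<bar> < \<epsilon>) \<ge> exp (real n * (x + h - \<delta>))"
      using 1 by (intro eventually_prob_near_ge_flat[OF deriv _ x \<epsilon> \<delta>]) auto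
    then show ?thesis
    proof eventually_elim
      case (elim n)
      have "exp (real n * (- B - \<delta>)) \<le> exp (real n * (x + h - \<delta>))"
        using \<open>- x - h \<le> B\<close> by (simp add: mult_left_mono)
      with elim show ?case by linarith
    qed
  next
    case 2
    define \<eta> where "\<eta> = min (\<epsilon> / 2) (\<delta> / 2)"
    have "\<exists>a>-1. x - \<eta> < D a"
    proof (rule ccontr)
      assume *: "\<not> (\<exists>a>-1. x - \<eta> < D a)"
      \<comment> \<open>If the slopes stayed below \<open>x - \<eta>\<close>, the mean value theorem
        would give \<open>x * b - L b \<ge> b * \<eta> - L 0\<close>, and this \<open>b\<close>
        makes that exceed \<open>B\<close>.\<close>
      define b where "b = (\<bar>B + L 0\<bar> + 1) / \<eta>"
      have "\<eta> > 0" using \<epsilon> \<delta> by (simp add: \<eta>_def)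
      then have b: "b > 0" by (simp add: b_def)
      obtain z where z: "0 < z" "z < b" "L b - L 0 = (b - 0) * D z"
        using MVT2[of 0 b L D] b deriv by force
      have "D z \<le> x - \<eta>" using * \<open>0 < z\<close> by (meson less_trans neg_less_0_iff_less not_le zero_less_one)
      then have "L b - L 0 \<le> b * (x - \<eta>)" using z(3) b by simp
      then have "x * b - L b \<ge> b * \<eta> - L 0" by (simp add: algebra_simps)
      moreover have "b * \<eta> = \<bar>B + L 0\<bar> + 1" using \<open>\<eta> > 0\<close> by (simp add: b_def)
      ultimately show False using B[of b] by linarith
    qed
    then show ?thesis using 2 exposed less_imp_le unfolding \<eta>_def by blast
  next
    case 3
    then show ?thesis using exposed[of a] \<epsilon> \<delta> by simp
  qed
qed

end

section \<open>The large deviation principle\<close>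

lemma liminf_log_prob_ge:
  assumes "\<forall>\<^sub>F n in sequentially. P n \<ge> exp (real n * r)"
  shows "liminf (\<lambda>n. log_prob (P n) / ereal (real n)) \<ge> ereal r"
proof (rule Liminf_bounded)
  show "\<forall>\<^sub>F n in sequentially. ereal r \<le> log_prob (P n) / ereal (real n)"
    using assms eventually_ge_at_top[of 1]
  proof eventually_elim
    case (elim n)
    have "P n > 0" using elim(1) by (rule less_le_trans[OF exp_gt_zero])
    moreover from this have "real n * r \<le> ln (P n)" using elim(1) by (simp add: ln_ge_iff)
    ultimately show ?case using elim(2) by (simp add: log_prob_def field_simps)
  qed
qed

lemma limsup_log_prob_le:
  assumes "\<forall>\<^sub>F n in sequentially. P n \<le> exp (real n * r)" "\<And>n. P n \<ge> 0"
  shows "limsup (\<lambda>n. log_prob (P n) / ereal (real n)) \<le> ereal r"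
proof (rule Limsup_bounded)
  show "\<forall>\<^sub>F n in sequentially. log_prob (P n) / ereal (real n) \<le> ereal r"
    using assms(1) eventually_ge_at_top[of 1]
  proof eventually_elim
    case (elim n)
    show ?case
    proof (cases "P n = 0")
      case False
      then have "P n > 0" using assms(2)[of n] by simp
      moreover from this have "ln (P n) \<le> real n * r" using elim(1) by (metis ln_exp ln_le_cancel_iff exp_gt_zero)
      ultimately show ?thesis using elim(2) by (simp add: log_prob_def field_simps)
    qed (use elim(2) in \<open>simp add: log_prob_def\<close>)
  qed
qed

text \<open>Real numbers strictly between the two sides turn the claim into the exponential bound,
  also when the infimum is infinite.\<close>

lemma (in bounded_cgf) limsup_closed_le:
  assumes "closed F"
  shows "limsup (\<lambda>n. log_prob (\<P>(\<omega> in M. W n \<omega> \<in> F)) / ereal (real n))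
      \<le> - (INF x\<in>F. legendre_transform L x)"
proof (rule dense_ge)
  fix z assume "- (INF x\<in>F. legendre_transform L x) < z"
  then obtain r where r: "- (INF x\<in>F. legendre_transform L x) < ereal r" "ereal r < z"
    using ereal_dense2 by blast
  then have "ereal (- r) < (INF x\<in>F. legendre_transform L x)"
    by (metis ereal_uminus_less_reorder uminus_ereal.simps(1))
  then obtain c where c: "ereal (- r) < ereal c" "ereal c < (INF x\<in>F. legendre_transform L x)"
    using ereal_dense2 by blast
  have "limsup (\<lambda>n. log_prob (\<P>(\<omega> in M. W n \<omega> \<in> F)) / ereal (real n)) \<le> ereal r"
    using c by (intro limsup_log_prob_le eventually_prob_closed_le[OF assms c(2)]) auto
  with r show "limsup (\<lambda>n. log_prob (\<P>(\<omega> in M. W n \<omega> \<in> F)) / ereal (real n)) \<le> z" by order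
qed

lemma (in antitone_guesswork) liminf_open_ge:
  assumes deriv: "\<And>a. a > - 1 \<Longrightarrow> (L has_real_derivative D a) (at a)"
    and cont: "continuous_on {- 1<..} D"
    and J: "open J"
  shows "liminf (\<lambda>n. log_prob (\<P>(\<omega> in M. W n \<omega> \<in> J)) / ereal (real n))
      \<ge> - (INF x\<in>J. legendre_transform L x)"
  unfolding ereal_SUP_uminus_eq[symmetric]
\<comment> \<open>The bound is local in \<open>x\<close>. Where the transform is infinite no
  \<open>z\<close> lies below its negative, so nothing is left to show.\<close>
proof (rule SUP_least, rule dense_le)
  fix x z assume x: "x \<in> J" and z: "z < - legendre_transform L x"
  then obtain r where r: "z < ereal r" "ereal r < - legendre_transform L x"
    using ereal_dense2 by blast
  then obtain s where s: "ereal r < ereal s" "ereal s < - legendre_transform L x"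
    using ereal_dense2 by blast
  have B: "x * a - L a \<le> - s" for a
  proof -
    have "ereal (x * a - L a) \<le> legendre_transform L x"
      unfolding legendre_transform_def by (rule SUP_upper) simp
    also have "\<dots> < ereal (- s)" using s(2) by (metis ereal_less_uminus_reorder uminus_ereal.simps(1))
    finally show ?thesis by simp
  qed
  obtain \<epsilon> where \<epsilon>: "\<epsilon> > 0" "\<And>y. \<bar>y - x\<bar> < \<epsilon> \<Longrightarrow> y \<in> J"
    using J x by (auto simp: open_dist dist_real_def)
  have "\<forall>\<^sub>F n in sequentially. \<P>(\<omega> in M. \<bar>W n \<omega> - x\<bar> < \<epsilon>) \<ge> exp (real n * (- (- s) - (s - r)))"
    using s(1) by (intro eventually_prob_near_ge[OF deriv cont B \<epsilon>(1)]) auto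
  then have "\<forall>\<^sub>F n in sequentially. \<P>(\<omega> in M. W n \<omega> \<in> J) \<ge> exp (real n * r)"
    using eventually_ge_at_top[of 1]
  proof eventually_elim
    case (elim n)
    have "\<P>(\<omega> in M. \<bar>W n \<omega> - x\<bar> < \<epsilon>) \<le> \<P>(\<omega> in M. W n \<omega> \<in> J)"
      using \<epsilon>(2) J by (intro finite_measure_mono W_measurable_set[OF elim(2)]) auto
    with elim(1) show ?case by simp
  qed
  then have "ereal r \<le> liminf (\<lambda>n. log_prob (\<P>(\<omega> in M. W n \<omega> \<in> J)) / ereal (real n))"
    by (rule liminf_log_prob_ge)
  with r(1) show "z \<le> liminf (\<lambda>n. log_prob (\<P>(\<omega> in M. W n \<omega> \<in> J)) / ereal (real n))" by order
qed

section \<open>Words and optimal guessing\<close>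

lemma initial_word_in_words: "initial_word X n \<omega> \<in> words n"
  by (simp add: initial_word_def words_def)

lemma measurable_initial_word:
  fixes X :: "nat \<Rightarrow> 'a \<Rightarrow> 'b::countable"
  assumes "\<And>i. i \<ge> 1 \<Longrightarrow> X i \<in> M \<rightarrow>\<^sub>M count_space UNIV"
  shows "initial_word X n \<in> M \<rightarrow>\<^sub>M count_space UNIV"
proof (induction n)
  case 0
  show ?case by (simp add: initial_word_def[abs_def])
next
  case (Suc n)
  have "(\<lambda>\<omega>. w @ [X (Suc n) \<omega>]) \<in> M \<rightarrow>\<^sub>M count_space UNIV" for w
    using assms[of "Suc n"] by measurable
  from measurable_compose_countable[OF this Suc.IH] show ?case
    by (simp add: initial_word_def[abs_def])
qed

lemma card_words: "card (words n :: 'x::finite list set) = CARD('x) ^ n"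
  using card_lists_length_eq[of "UNIV :: 'x set" n] by (simp add: words_def)

text \<open>An injection between finite sets of equal size is onto, so for each \<open>y\<close>
  every guess number belongs to exactly one word.\<close>

lemma guessing_function_bij:
  fixes g :: "'x::finite list \<Rightarrow> 'y list \<Rightarrow> nat"
  assumes "guessing_function n g" "y \<in> words n"
  shows "bij_betw (\<lambda>x. g x y) (words n) {1..CARD('x) ^ n}"
proof -
  have inj: "inj_on (\<lambda>x. g x y) (words n)" and "(\<lambda>x. g x y) ` words n \<subseteq> {1..CARD('x) ^ n}"
    using assms by (auto simp: guessing_function_def)
  then have "(\<lambda>x. g x y) ` words n = {1..CARD('x) ^ n}"
    by (intro card_subset_eq) (simp_all add: card_image card_words)
  with inj show ?thesis by (simp add: bij_betw_def)
qed

text \<open>For fixed \<open>y\<close> the \<open>k\<close>-th guess is a single word, and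
  optimality orders the words by conditional probability. Summing over \<open>y\<close> keeps the
  order.\<close>

lemma prob_guess_antitone:
  fixes X :: "nat \<Rightarrow> 'a \<Rightarrow> 'x::finite" and Y :: "nat \<Rightarrow> 'a \<Rightarrow> 'y::countable"
  assumes "prob_space M"
    and X: "\<And>i. i \<ge> 1 \<Longrightarrow> X i \<in> M \<rightarrow>\<^sub>M count_space UNIV"
    and Y: "\<And>i. i \<ge> 1 \<Longrightarrow> Y i \<in> M \<rightarrow>\<^sub>M count_space UNIV"
    and opt: "optimal_guessing_function M X Y n g"
    and jk: "1 \<le> j" "j \<le> k" "k \<le> CARD('x) ^ n"
  shows "\<P>(\<omega> in M. g (initial_word X n \<omega>) (initial_word Y n \<omega>) = k)
       \<le> \<P>(\<omega> in M. g (initial_word X n \<omega>) (initial_word Y n \<omega>) = j)"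
proof -
  interpret prob_space M by fact
  define U where "U = initial_word X n"
  define V where "V = initial_word Y n"
  have [measurable]: "U \<in> M \<rightarrow>\<^sub>M count_space UNIV" "V \<in> M \<rightarrow>\<^sub>M count_space UNIV"
    unfolding U_def V_def by (intro measurable_initial_word X Y; assumption)+
  have g: "guessing_function n g" using opt by (simp add: optimal_guessing_function_def)
  have UV: "U \<omega> \<in> words n" "V \<omega> \<in> words n" for \<omega>
    by (simp_all add: U_def V_def initial_word_in_words)
  define E where "E i y = {\<omega> \<in> space M. g (U \<omega>) y = i \<and> V \<omega> = y}" for i y
  have E_sets: "E i y \<in> sets M" for i y
    unfolding E_def by measurable
  have E_eq: "E i y = {\<omega> \<in> space M. U \<omega> = x \<and> V \<omega> = y}"
    if "y \<in> words n" "x \<in> words n" "g x y = i" for i x y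
    using bij_betw_imp_inj_on[OF guessing_function_bij[OF g that(1)]] that(2,3) UV
    by (auto simp: E_def dest: inj_onD)
  have E_le: "prob (E k y) \<le> prob (E j y)" if y: "y \<in> words n" for y
  proof (cases "\<P>(\<omega> in M. V \<omega> = y) = 0")
    \<comment> \<open>Optimality says nothing about a null \<open>y\<close>, but there both events
      are null.\<close>
    case True
    have "prob (E k y) \<le> \<P>(\<omega> in M. V \<omega> = y)"
      by (intro finite_measure_mono) (auto simp: E_def)
    with True show ?thesis by (simp add: measure_le_0_iff)
  next
    case False
    then have pos: "\<P>(\<omega> in M. V \<omega> = y) > 0" by (simp add: zero_less_measure_iff)
    have "j \<in> (\<lambda>x. g x y) ` words n" "k \<in> (\<lambda>x. g x y) ` words n"
      using jk bij_betw_imp_surj_on[OF guessing_function_bij[OF g y]] by auto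
    then obtain x x' where x: "x \<in> words n" "g x y = k" "x' \<in> words n" "g x' y = j" by auto
    then have "\<P>(\<omega> in M. U \<omega> = x' \<bar> V \<omega> = y) \<ge> \<P>(\<omega> in M. U \<omega> = x \<bar> V \<omega> = y)"
      using opt y pos jk by (simp add: optimal_guessing_function_def U_def V_def)
    with pos x y show ?thesis
      by (simp add: cond_prob_def divide_le_cancel E_eq)
  qed
  \<comment> \<open>There may be infinitely many \<open>y\<close>; in the extended nonnegative reals
    the sum needs no summability argument.\<close>
  have emeasure_eq: "emeasure M {\<omega> \<in> space M. g (U \<omega>) (V \<omega>) = i}
      = (\<integral>\<^sup>+y. emeasure M (E i y) \<partial>count_space (words n))" for i
  proof -
    have "{\<omega> \<in> space M. g (U \<omega>) (V \<omega>) = i} = (\<Union>y\<in>words n. E i y)"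
      using UV by (auto simp: E_def)
    moreover have "disjoint_family_on (E i) (words n)"
      by (auto simp: disjoint_family_on_def E_def)
    ultimately show ?thesis
      by (simp add: emeasure_UN_countable E_sets)
  qed
  have "emeasure M {\<omega> \<in> space M. g (U \<omega>) (V \<omega>) = k} \<le> emeasure M {\<omega> \<in> space M. g (U \<omega>) (V \<omega>) = j}"
    unfolding emeasure_eq using E_le by (intro nn_integral_mono) (simp add: emeasure_eq_measure)
  then show ?thesis by (simp add: emeasure_eq_measure U_def V_def)
qed

theorem theorem3p3:
  fixes M :: "'a measure"
    and X :: "nat \<Rightarrow> 'a \<Rightarrow> 'x::finite"
    and Y :: "nat \<Rightarrow> 'a \<Rightarrow> 'y::countable"
    and G :: "nat \<Rightarrow> 'x list \<Rightarrow> 'y list \<Rightarrow> nat"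
  defines "\<Lambda> \<equiv> limit_cgf M X Y G"
  assumes "prob_space M"
    and "\<And>i. i \<ge> 1 \<Longrightarrow> X i \<in> M \<rightarrow>\<^sub>M count_space UNIV"
    and "\<And>i. i \<ge> 1 \<Longrightarrow> Y i \<in> M \<rightarrow>\<^sub>M count_space UNIV"
    and "\<And>n. n \<ge> 1 \<Longrightarrow> optimal_guessing_function M X Y n (G n)"
    and "\<And>\<alpha>. \<alpha> > -1 \<Longrightarrow> convergent (scaled_cgf M X Y G \<alpha>)"
    and "\<exists>\<Lambda>'. (\<forall>\<alpha>>-1. (\<Lambda> has_real_derivative \<Lambda>' \<alpha>) (at \<alpha>)) \<and> continuous_on {-1<..} \<Lambda>'"
    and "\<And>\<alpha>. \<alpha> > -1 \<Longrightarrow> convergent (renyi_per_symbol M X Y (1 / (1 + \<alpha>)))"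
    and "\<And>\<alpha>. \<alpha> > -1 \<Longrightarrow> \<Lambda> \<alpha> = \<alpha> * renyi_rate M X Y (1 / (1 + \<alpha>))"
  shows "(\<forall>F::real set. closed F \<longrightarrow>
            limsup (\<lambda>n. log_prob (\<P>(\<omega> in M. ln (guesswork X Y G n \<omega>) / real n \<in> F)) / ereal (real n))
              \<le> - (INF x\<in>F. legendre_transform \<Lambda> x)) \<and>
         (\<forall>J::real set. open J \<longrightarrow>
            liminf (\<lambda>n. log_prob (\<P>(\<omega> in M. ln (guesswork X Y G n \<omega>) / real n \<in> J)) / ereal (real n))
              \<ge> - (INF x\<in>J. legendre_transform \<Lambda> x))"
proof -
  obtain D where deriv: "\<And>a. a > - 1 \<Longrightarrow> (\<Lambda> has_real_derivative D a) (at a)"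
    and cont: "continuous_on {- 1<..} D"
    using assms(7) by auto
  define Z where "Z n \<omega> = G n (initial_word X n \<omega>) (initial_word Y n \<omega>)" for n \<omega>
  have guess: "guessing_function n (G n)" if "n \<ge> 1" for n
    using assms(5)[OF that] by (simp add: optimal_guessing_function_def)
  \<comment> \<open>Optimality enters only here, as the decrease of the masses of
    \<open>Z n\<close>.\<close>
  have "antitone_guesswork M Z CARD('x) \<Lambda>"
  proof (intro antitone_guesswork.intro antitone_guesswork_axioms.intro)
    show "prob_space M" by fact
  next
    fix n :: nat assume "n \<ge> 1"
    have "(\<lambda>\<omega>. G n x (initial_word Y n \<omega>)) \<in> M \<rightarrow>\<^sub>M count_space UNIV" for x
      using measurable_initial_word[of Y M n] assms(4) by measurable
    from measurable_compose_countable[OF this measurable_initial_word[of X M n]] assms(3)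
    show "Z n \<in> M \<rightarrow>\<^sub>M count_space UNIV" by (simp add: Z_def[abs_def])
  next
    fix n :: nat and \<omega> assume "n \<ge> 1"
    from guess[OF this] show "Z n \<omega> \<in> {1..CARD('x) ^ n}"
      using initial_word_in_words[of X n \<omega>] initial_word_in_words[of Y n \<omega>]
      unfolding guessing_function_def Z_def by blast
  next
    fix n j k :: nat assume "n \<ge> 1" "1 \<le> j" "j \<le> k" "k \<le> CARD('x) ^ n"
    then show "\<P>(\<omega> in M. Z n \<omega> = k) \<le> \<P>(\<omega> in M. Z n \<omega> = j)"
      unfolding Z_def using assms(2-5) by (intro prob_guess_antitone[of M X Y]) auto
  next
    fix a :: real assume "a > - 1"
    from assms(6)[OF this]
    show "convergent (\<lambda>n. ln (prob_space.expectation M (\<lambda>\<omega>. real (Z n \<omega>) powr a)) / real n)"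
      by (simp add: scaled_cgf_def[abs_def] guesswork_def Z_def)
  next
    fix a :: real
    show "\<Lambda> a = lim (\<lambda>n. ln (prob_space.expectation M (\<lambda>\<omega>. real (Z n \<omega>) powr a)) / real n)"
      by (simp add: \<Lambda>_def limit_cgf_def scaled_cgf_def[abs_def] guesswork_def Z_def)
  qed
  then interpret antitone_guesswork M Z "CARD('x)" \<Lambda> .
  have "ln (guesswork X Y G n \<omega>) / real n = W n \<omega>" for n \<omega>
    by (simp add: W_def guesswork_def Z_def)
  then show ?thesis
    using limsup_closed_le liminf_open_ge[OF deriv cont] by simp
qed

end
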